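(* Let $n\geq 2$ and let $Z$ be a closed subset of $\mathbb{P}^n(\mathbb{R})$ (for the topology induced by the projective distance). Suppose there exists a non-empty set $Z'\subseteq Z(\mathbb{Q})$ with the following property: for each proper projective subspace $H$ of $\mathbb{P}^n(\mathbb{R})$ defined over $\mathbb{Q}$ there is a function $s_H:Z'\to\mathbb{N}$ such that, for each $x\in Z'$, (i) if $s_H(x)=0$, then $x\notin H$; (ii) if $s_H(x)\geq1$, then there exists a projective line $L$ defined over $\mathbb{Q}$ such that $x\in L(\mathbb{Q})\subseteq Z'$ and $\#\{y\in L(\mathbb{Q})\,;\,s_H(y)\geq s_H(x)\}<\infty$. Let $\phi:[1,\infty)\to(0,1]$ be a monotonically decreasing function with $\lim_{X\to\infty}\phi(X)=0$ and $\lim_{X\to\infty}X\phi(X)=\infty$. Then there are uncountably many $\xi\in Z^{\mathrm{li}}$ such that $\mathcal{D}_\xi(X)\leq\phi(X)$ for all sufficiently large $X$.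
   Context: $\mathbb{N}=\{0,1,2,\dots\}$. For $Z\subseteq\mathbb{P}^n(\mathbb{R})$, $Z(\mathbb{Q})=Z\cap\mathbb{P}^n(\mathbb{Q})$; similarly $L(\mathbb{Q})=L\cap\mathbb{P}^n(\mathbb{Q})$. For a nonzero $\mathbf{x}\in\mathbb{R}^{n+1}$, $[\mathbf{x}]$ denotes its class in $\mathbb{P}^n(\mathbb{R})$. $Z^{\mathrm{li}}$ is the set of points of $Z$ having a representative in $\mathbb{R}^{n+1}$ whose coordinates are linearly independent over $\mathbb{Q}$. The projective distance is $\mathrm{dist}([\mathbf{x}],[\mathbf{y}])=\|\mathbf{x}\wedge\mathbf{y}\|/(\|\mathbf{x}\|\,\|\mathbf{y}\|)$, with $\|\cdot\|$ the Euclidean norm. For $\xi=[\boldsymbol{\xi}]$ and nonzero $\mathbf{x}\in\mathbb{Z}^{n+1}$, $D_\xi(\mathbf{x})=\|\mathbf{x}\wedge\boldsymbol{\xi}\|/\|\boldsymbol{\xi}\|$, and for $X\geq1$, $\mathcal{D}_\xi(X)=\min\{D_\xi(\mathbf{x})\,;\,\mathbf{x}\in\mathbb{Z}^{n+1}\setminus\{0\},\ \|\mathbf{x}\|\leq X\}$. *)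

theory Defs
  imports "HOL-Analysis.Analysis"
begin

section \<open>The wedge of two vectors\<close>

text \<open>
  The coordinates of \<open>x \<and> y\<close> are the minors \<open>x\<^sub>i y\<^sub>j - x\<^sub>j y\<^sub>i\<close> with \<open>i < j\<close>.  The index type is
  not ordered, so the sum below runs over all pairs, which counts every squared minor twice
  (see \<open>wedge_norm_ordered\<close>).
\<close>

definition wedge_norm :: "real^'n \<Rightarrow> real^'n \<Rightarrow> real" where
  "wedge_norm x y = sqrt ((\<Sum>i\<in>UNIV. \<Sum>j\<in>UNIV. (x $ i * y $ j - x $ j * y $ i)\<^sup>2) / 2)"

lemma wedge_norm_ordered:
  fixes x y :: "real^'n::{finite,linorder}"
  shows "wedge_norm x y = sqrt (\<Sum>(i,j)\<in>{(i,j). i < j}. (x $ i * y $ j - x $ j * y $ i)\<^sup>2)"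
proof -
  let ?f = "\<lambda>(i,j). (x $ i * y $ j - x $ j * y $ i)\<^sup>2"
  have U: "(UNIV :: ('n \<times> 'n) set) = {(i,j). i < j} \<union> {(i,j). j < i} \<union> {(i,j). i = j}"
    by (auto simp: not_less)
  have "(\<Sum>i\<in>UNIV. \<Sum>j\<in>UNIV. ?f (i,j)) = sum ?f UNIV"
    by (simp add: sum.cartesian_product)
  also have "\<dots> = sum ?f {(i,j). i < j} + sum ?f {(i,j). j < i} + sum ?f {(i,j). i = j}"
    by (subst U, subst sum.union_disjoint, simp, simp, fastforce,
        subst sum.union_disjoint, simp, simp, fastforce, simp)
  also have "sum ?f {(i,j). i = j} = 0"
    by (intro sum.neutral) auto
  also have "sum ?f {(i,j). j < i} = sum ?f {(i,j). i < j}"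
    by (rule sum.reindex_bij_witness[of _ prod.swap prod.swap])
       (auto simp: power2_commute mult.commute)
  finally show ?thesis
    by (simp add: wedge_norm_def)
qed

lemma wedge_norm_lagrange:
  "(wedge_norm x y)\<^sup>2 = (norm x)\<^sup>2 * (norm y)\<^sup>2 - (x \<bullet> y)\<^sup>2"
proof -
  have a: "(\<Sum>i\<in>UNIV. \<Sum>j\<in>UNIV. (x $ i * y $ j - x $ j * y $ i)\<^sup>2) =
     (\<Sum>i\<in>UNIV. \<Sum>j\<in>UNIV. (x $ i * x $ i) * (y $ j * y $ j)
        + (y $ i * y $ i) * (x $ j * x $ j) - 2 * ((x $ i * y $ i) * (x $ j * y $ j)))"
    by (intro sum.cong refl) (simp add: power2_eq_square algebra_simps)
  also have "\<dots> = (x \<bullet> x) * (y \<bullet> y) + (y \<bullet> y) * (x \<bullet> x) - 2 * ((x \<bullet> y) * (x \<bullet> y))"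
    by (simp add: sum.distrib sum_subtractf sum_product inner_vec_def flip: sum_distrib_left)
  finally have b: "(\<Sum>i\<in>UNIV. \<Sum>j\<in>UNIV. (x $ i * y $ j - x $ j * y $ i)\<^sup>2) / 2
      = (norm x)\<^sup>2 * (norm y)\<^sup>2 - (x \<bullet> y)\<^sup>2"
    by (simp only: power2_norm_eq_inner) (simp add: power2_eq_square)
  have "(\<Sum>i\<in>UNIV. \<Sum>j\<in>UNIV. (x $ i * y $ j - x $ j * y $ i)\<^sup>2) / 2 \<ge> 0"
    by (intro divide_nonneg_nonneg sum_nonneg) auto
  then show ?thesis
    unfolding wedge_norm_def using b by simp
qed

lemma wedge_norm_nonneg: "wedge_norm x y \<ge> 0"
  unfolding wedge_norm_def by (intro real_sqrt_ge_zero divide_nonneg_nonneg sum_nonneg) auto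

lemma wedge_norm_eq: "wedge_norm x y = sqrt ((norm x)\<^sup>2 * (norm y)\<^sup>2 - (x \<bullet> y)\<^sup>2)"
  by (metis wedge_norm_lagrange wedge_norm_nonneg real_sqrt_unique)

lemma wedge_norm_scaleR: "wedge_norm (a *\<^sub>R x) (b *\<^sub>R y) = \<bar>a\<bar> * \<bar>b\<bar> * wedge_norm x y"
proof -
  have "(norm (a *\<^sub>R x))\<^sup>2 * (norm (b *\<^sub>R y))\<^sup>2 - ((a *\<^sub>R x) \<bullet> (b *\<^sub>R y))\<^sup>2
      = (\<bar>a\<bar> * \<bar>b\<bar>)\<^sup>2 * ((norm x)\<^sup>2 * (norm y)\<^sup>2 - (x \<bullet> y)\<^sup>2)"
    by (simp add: power_mult_distrib algebra_simps)
  then show ?thesis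
    unfolding wedge_norm_eq by (simp add: real_sqrt_mult)
qed

section \<open>Real projective space\<close>

text \<open>Points of \<open>'n rproj\<close> are the classes of nonzero vectors of \<open>real^'n\<close>, so that it is
  projective space of dimension \<open>CARD('n) - 1\<close>.\<close>

definition proportional :: "real^'n \<Rightarrow> real^'n \<Rightarrow> bool" where
  "proportional x y \<longleftrightarrow> x \<noteq> 0 \<and> y \<noteq> 0 \<and> (\<exists>c. y = c *\<^sub>R x)"

lemma part_equivp_proportional: "part_equivp (proportional :: real^'n \<Rightarrow> real^'n \<Rightarrow> bool)"
proof (rule part_equivpI)
  have "proportional (axis undefined 1 :: real^'n) (axis undefined 1)"
    unfolding proportional_def by (auto simp: axis_eq_0_iff intro: exI[of _ 1])
  then show "\<exists>x :: real^'n. proportional x x" ..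
  show "symp (proportional :: real^'n \<Rightarrow> real^'n \<Rightarrow> bool)"
  proof (rule sympI)
    fix x y :: "real^'n"
    assume "proportional x y"
    then obtain c where c: "x \<noteq> 0" "y \<noteq> 0" "y = c *\<^sub>R x"
      unfolding proportional_def by auto
    then have "x = (1 / c) *\<^sub>R y" by auto
    with c show "proportional y x" unfolding proportional_def by blast
  qed
  show "transp (proportional :: real^'n \<Rightarrow> real^'n \<Rightarrow> bool)"
    by (rule transpI) (fastforce simp: proportional_def)
qed

quotient_type 'n rproj = "real^'n::finite" / partial: proportional
  by (rule part_equivp_proportional)

text \<open>\<open>proj_class x\<close> is the class of \<open>x\<close>; it is only meaningful for nonzero \<open>x\<close>.\<close>

definition proj_class :: "real^'n \<Rightarrow> 'n rproj" where
  "proj_class x = abs_rproj x"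

lemma proj_class_eq_iff:
  assumes "x \<noteq> 0" "y \<noteq> 0"
  shows "proj_class x = proj_class y \<longleftrightarrow> (\<exists>c. y = c *\<^sub>R x)"
proof -
  have refl: "proportional z z" if "z \<noteq> 0" for z :: "real^'n"
    using that unfolding proportional_def by (auto intro: exI[of _ 1])
  have "proj_class x = proj_class y \<longleftrightarrow> proportional x y"
    unfolding proj_class_def
    using Quotient_rel[OF Quotient_rproj, of x y] refl assms by blast
  then show ?thesis
    using assms by (simp add: proportional_def)
qed

lemma proj_class_cases: obtains x where "x \<noteq> 0" "p = proj_class x"
proof
  have "proportional (rep_rproj p) (rep_rproj p)"
    by (rule Quotient_rep_reflp[OF Quotient_rproj])
  then show "rep_rproj p \<noteq> 0"
    by (simp add: proportional_def)
  show "p = proj_class (rep_rproj p)"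
    unfolding proj_class_def by (simp add: Quotient_abs_rep[OF Quotient_rproj])
qed

lift_definition proj_dist :: "'n::finite rproj \<Rightarrow> 'n rproj \<Rightarrow> real"
  is "\<lambda>x y. wedge_norm x y / (norm x * norm y)"
  by (auto simp: proportional_def wedge_norm_scaleR)

lemma proj_dist_class:
  "x \<noteq> 0 \<Longrightarrow> y \<noteq> 0 \<Longrightarrow>
     proj_dist (proj_class x) (proj_class y) = wedge_norm x y / (norm x * norm y)"
  unfolding proj_class_def
  by (rule proj_dist.abs_eq) (auto simp: proportional_def intro: exI[of _ 1])

lemma rproj_unit_cases:
  obtains x where "norm x = 1" "p = proj_class x"
proof -
  obtain x where x: "x \<noteq> 0" "p = proj_class x" by (rule proj_class_cases)
  have "proj_class x = proj_class ((1 / norm x) *\<^sub>R x)"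
    using x by (subst proj_class_eq_iff) auto
  with x that[of "(1 / norm x) *\<^sub>R x"] show ?thesis by simp
qed

text \<open>Up to a factor \<open>sqrt 2\<close>, the projective distance is the Frobenius distance of the
  orthogonal projections onto the two lines; this gives the triangle inequality.\<close>

definition line_projection :: "real^'n \<Rightarrow> real^'n^'n" where
  "line_projection x = (\<chi> i j. x $ i * x $ j)"

lemma proj_dist_unit:
  assumes "norm x = 1" "norm y = 1"
  shows "proj_dist (proj_class x) (proj_class y)
           = dist (line_projection x) (line_projection y) / sqrt 2"
proof -
  have inner: "line_projection u \<bullet> line_projection v = (u \<bullet> v)\<^sup>2" for u v :: "real^'n"
  proof -
    have "line_projection u \<bullet> line_projection v
        = (\<Sum>i\<in>UNIV. \<Sum>j\<in>UNIV. (u $ i * v $ i) * (u $ j * v $ j))"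
      unfolding line_projection_def inner_vec_def
      by (intro sum.cong refl) (simp add: inner_vec_def algebra_simps)
    then show ?thesis
      by (simp add: power2_eq_square inner_vec_def sum_product)
  qed
  have u: "x \<bullet> x = 1" "y \<bullet> y = 1"
    using assms by (simp_all add: norm_eq_1)
  have "(dist (line_projection x) (line_projection y))\<^sup>2 = 2 * (1 - (x \<bullet> y)\<^sup>2)"
    unfolding dist_norm power2_norm_eq_inner
    using u by (simp add: inner_diff_left inner_diff_right inner inner_commute[of y x])
  then have "dist (line_projection x) (line_projection y) = sqrt 2 * sqrt (1 - (x \<bullet> y)\<^sup>2)"
    unfolding real_sqrt_mult[symmetric] by (metis real_sqrt_unique zero_le_dist)
  moreover have "x \<noteq> 0" "y \<noteq> 0" using assms by auto
  ultimately show ?thesis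
    using assms by (simp add: proj_dist_class wedge_norm_eq)
qed

instantiation rproj :: (finite) metric_space
begin

definition dist_rproj :: "'a rproj \<Rightarrow> 'a rproj \<Rightarrow> real" where
  "dist_rproj = proj_dist"

definition uniformity_rproj :: "('a rproj \<times> 'a rproj) filter" where
  "uniformity_rproj = (INF e\<in>{0 <..}. principal {(p, q). dist p q < e})"

definition open_rproj :: "'a rproj set \<Rightarrow> bool" where
  "open_rproj U = (\<forall>p\<in>U. eventually (\<lambda>(p', q). p' = p \<longrightarrow> q \<in> U) uniformity)"

instance
proof
  fix p q r :: "'a rproj"
  obtain x y z where x: "norm x = 1" "p = proj_class x" and y: "norm y = 1" "q = proj_class y"
    and z: "norm z = 1" "r = proj_class z"
    by (meson rproj_unit_cases)
  have nz: "x \<noteq> 0" "y \<noteq> 0" using x y by auto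
  show "dist p q \<le> dist p r + dist q r"
    using dist_triangle2[of "line_projection x" "line_projection y" "line_projection z"]
    by (simp add: x y z dist_rproj_def proj_dist_unit field_simps)
  show "dist p q = 0 \<longleftrightarrow> p = q"
  proof
    assume "dist p q = 0"
    then have "line_projection x = line_projection y"
      by (simp add: x y dist_rproj_def proj_dist_unit)
    then have eq: "x $ i * x $ j = y $ i * y $ j" for i j
      by (simp add: line_projection_def vec_eq_iff)
    obtain k where k: "x $ k \<noteq> 0"
      using nz by (auto simp: vec_eq_iff)
    with eq[of k k] have k': "y $ k \<noteq> 0" by auto
    have "y = (x $ k / y $ k) *\<^sub>R x"
      using eq[of k] k' by (simp add: vec_eq_iff field_simps)
    then show "p = q"
      using nz by (auto simp: x y proj_class_eq_iff)
  qed (simp add: x y dist_rproj_def proj_dist_unit)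
qed (fact uniformity_rproj_def open_rproj_def)+

end

section \<open>Rational points and subspaces\<close>

definition rational_vec :: "real^'n \<Rightarrow> bool" where
  "rational_vec x \<longleftrightarrow> (\<forall>i. x $ i \<in> \<rat>)"

definition integral_vec :: "real^'n \<Rightarrow> bool" where
  "integral_vec x \<longleftrightarrow> (\<forall>i. x $ i \<in> \<int>)"

definition rational_points :: "'n::finite rproj set \<Rightarrow> 'n rproj set" where
  "rational_points Z = Z \<inter> {proj_class x | x. x \<noteq> 0 \<and> rational_vec x}"

definition projectivization :: "(real^'n) set \<Rightarrow> 'n rproj set" where
  "projectivization V = {proj_class x | x. x \<noteq> 0 \<and> x \<in> V}"

definition subspace_over_rat :: "(real^'n) set \<Rightarrow> bool" where
  "subspace_over_rat V \<longleftrightarrow> (\<exists>B. (\<forall>b\<in>B. rational_vec b) \<and> V = span B)"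

text \<open>The empty set (the case \<open>V = {0}\<close>) counts as a projective subspace.\<close>

definition proj_subspace_over_rat :: "'n::finite rproj set \<Rightarrow> bool" where
  "proj_subspace_over_rat H \<longleftrightarrow> (\<exists>V. subspace_over_rat V \<and> H = projectivization V)"

definition proj_line_over_rat :: "'n::finite rproj set \<Rightarrow> bool" where
  "proj_line_over_rat L \<longleftrightarrow> (\<exists>V. subspace_over_rat V \<and> dim V = 2 \<and> L = projectivization V)"

definition rat_independent_coords :: "real^'n \<Rightarrow> bool" where
  "rat_independent_coords x \<longleftrightarrow>
     (\<forall>c :: 'n \<Rightarrow> rat. (\<Sum>i\<in>UNIV. of_rat (c i) * x $ i) = 0 \<longrightarrow> (\<forall>i. c i = 0))"

definition li_points :: "'n::finite rproj set \<Rightarrow> 'n rproj set" where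
  "li_points Z = {p \<in> Z. \<exists>x. x \<noteq> 0 \<and> p = proj_class x \<and> rat_independent_coords x}"

section \<open>Rational approximation\<close>

lift_definition approx_dist :: "'n::finite rproj \<Rightarrow> real^'n \<Rightarrow> real"
  is "\<lambda>\<xi> x. wedge_norm x \<xi> / norm \<xi>"
  by (auto simp: proportional_def fun_eq_iff wedge_norm_scaleR[of 1, simplified])

lemma approx_dist_class:
  "\<xi> \<noteq> 0 \<Longrightarrow> approx_dist (proj_class \<xi>) x = wedge_norm x \<xi> / norm \<xi>"
  unfolding proj_class_def
  by (subst approx_dist.abs_eq) (auto simp: proportional_def intro: exI[of _ 1])

definition approx_set :: "'n::finite rproj \<Rightarrow> real \<Rightarrow> real set" where
  "approx_set \<xi> X = {approx_dist \<xi> x | x. integral_vec x \<and> x \<noteq> 0 \<and> norm x \<le> X}"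

text \<open>The minimum is genuine for \<open>X \<ge> 1\<close>: see \<open>finite_approx_set\<close> and \<open>approx_set_nonempty\<close>.\<close>

definition min_approx :: "'n::finite rproj \<Rightarrow> real \<Rightarrow> real" where
  "min_approx \<xi> X = Min (approx_set \<xi> X)"

lemma finite_approx_set: "finite (approx_set \<xi> X)"
proof -
  let ?F = "{k::real. k \<in> \<int> \<and> \<bar>k\<bar> \<le> X}"
  have "finite ?F"
    by (rule finite_abs_int_segment)
  then have "finite {f :: 'a \<Rightarrow> real. \<forall>i. f i \<in> ?F}"
    using finite_set_of_finite_funs[of "UNIV :: 'a set" ?F] by simp
  moreover have "{x :: real^'a. integral_vec x \<and> x \<noteq> 0 \<and> norm x \<le> X}
      \<subseteq> vec_lambda ` {f. \<forall>i. f i \<in> ?F}"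
  proof
    fix x :: "real^'a"
    assume x: "x \<in> {x. integral_vec x \<and> x \<noteq> 0 \<and> norm x \<le> X}"
    then have "x $ i \<in> ?F" for i
      using component_le_norm_cart[of x i] by (auto simp: integral_vec_def)
    then show "x \<in> vec_lambda ` {f. \<forall>i. f i \<in> ?F}"
      by (intro image_eqI[of _ _ "\<lambda>i. x $ i"]) auto
  qed
  ultimately have "finite {x :: real^'a. integral_vec x \<and> x \<noteq> 0 \<and> norm x \<le> X}"
    by (meson finite_imageI finite_subset)
  then show ?thesis
    unfolding approx_set_def by simp
qed

lemma approx_set_nonempty: "X \<ge> 1 \<Longrightarrow> approx_set \<xi> X \<noteq> {}"
  unfolding approx_set_def integral_vec_def
  by (auto intro!: exI[of _ "axis undefined 1"] simp: axis_eq_0_iff) (simp add: axis_def)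

end

theory Submission
  imports Defs
begin

text \<open>
  Moving from an integral point \<open>x\<close> to \<open>y + k x\<close> on a rational line keeps \<open>x \<and> (y + k x)\<close> fixed,
  so \<open>x\<close> approximates its successor, and any limit point close enough to it, within \<open>\<phi>\<close> of the
  successor's norm once \<open>k\<close> is large.  Along the lines of the hypothesis such moves decrease \<open>s\<^sub>H\<close>
  until the current point leaves \<open>H\<close>, and a smaller ball then keeps the limit out of \<open>H\<close> for good.
  Running through all rational hyperplanes, and through the points of a supposed countable set of
  solutions, gives a further solution.
\<close>

section \<open>Metric and compactness of real projective space\<close>

lemma dist_proj_class:
  "x \<noteq> 0 \<Longrightarrow> y \<noteq> 0 \<Longrightarrow>
     dist (proj_class x) (proj_class y) = wedge_norm x y / (norm x * norm y)"
  by (simp add: dist_rproj_def proj_dist_class)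

lemma wedge_norm_add_multiple: "wedge_norm x (y + k *\<^sub>R x) = wedge_norm x y"
  unfolding wedge_norm_def by (simp add: algebra_simps)

text \<open>For a fixed integral point, a bound on \<open>approx_dist\<close> thus amounts to
  confining \<open>\<xi>\<close> to a ball around the class of that point. This lets nested balls
  enforce all approximation conditions at once.\<close>

lemma approx_dist_eq_dist:
  assumes "x \<noteq> 0"
  shows "approx_dist \<xi> x = norm x * dist (proj_class x) \<xi>"
proof -
  obtain z where "z \<noteq> 0" "\<xi> = proj_class z"
    by (rule proj_class_cases)
  then show ?thesis
    using assms by (simp add: approx_dist_class dist_proj_class)
qed

text \<open>For unit vectors the projective distance is a constant multiple of the distance between
  the matrices \<open>line_projection\<close>, whose entries are polynomials in the
  coordinates.\<close>

lemma continuous_on_proj_class: "continuous_on (sphere 0 1) proj_class"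
proof -
  have lp: "continuous_on (sphere 0 1) line_projection"
    unfolding line_projection_def by (intro continuous_intros)
  show ?thesis
    unfolding continuous_on_iff
  proof (intro ballI allI impI)
    fix x :: "real^'a" and e :: real
    assume x: "x \<in> sphere 0 1" and e: "e > 0"
    then obtain d where "d > 0" and
      d: "\<And>y. y \<in> sphere 0 1 \<Longrightarrow> dist y x < d \<Longrightarrow>
            dist (line_projection y) (line_projection x) < e * sqrt 2"
      using lp[unfolded continuous_on_iff, rule_format, of x "e * sqrt 2"] by auto
    have "dist (proj_class y) (proj_class x) < e" if "y \<in> sphere 0 1" "dist y x < d" for y
      using d[OF that] x that by (simp add: dist_rproj_def proj_dist_unit field_simps)
    with \<open>d > 0\<close> show "\<exists>d>0. \<forall>x'\<in>sphere 0 1. dist x' x < d \<longrightarrow>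
        dist (proj_class x') (proj_class x) < e"
      by blast
  qed
qed

text \<open>Every class has a unit representative, so the set is a continuous image of a compact
  part of the sphere. The whole space is used for the nested balls; rational hyperplanes are used as
  closed sets to be avoided.\<close>

lemma compact_projectivization:
  assumes "subspace V"
  shows "compact (projectivization V)"
proof -
  have "projectivization V = proj_class ` (sphere 0 1 \<inter> V)"
  proof (intro equalityI subsetI)
    fix p assume "p \<in> projectivization V"
    then obtain x where x: "x \<noteq> 0" "x \<in> V" "p = proj_class x"
      unfolding projectivization_def by auto
    then have "proj_class x = proj_class ((1 / norm x) *\<^sub>R x)"
      by (subst proj_class_eq_iff) auto
    moreover have "(1 / norm x) *\<^sub>R x \<in> sphere 0 1 \<inter> V"
      using x subspace_scale[OF assms] by auto
    ultimately show "p \<in> proj_class ` (sphere 0 1 \<inter> V)"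
      using x by blast
  qed (auto simp: projectivization_def)
  moreover have "compact (sphere 0 1 \<inter> V)"
    by (intro compact_Int_closed closed_subspace assms compact_sphere)
  ultimately show ?thesis
    by (metis compact_continuous_image continuous_on_proj_class continuous_on_subset inf_le1)
qed

lemma compact_UNIV_rproj: "compact (UNIV :: 'n::finite rproj set)"
proof -
  have "(UNIV :: 'n rproj set) = projectivization UNIV"
    unfolding projectivization_def by (auto intro: proj_class_cases)
  then show ?thesis
    by (metis compact_projectivization subspace_UNIV)
qed

lemma proj_class_mem_projectivization_iff:
  assumes "subspace V" "x \<noteq> 0"
  shows "proj_class x \<in> projectivization V \<longleftrightarrow> x \<in> V"
proof
  assume "proj_class x \<in> projectivization V"
  then obtain y where y: "y \<noteq> 0" "y \<in> V" "proj_class y = proj_class x"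
    unfolding projectivization_def by auto
  then show "x \<in> V"
    using assms by (auto simp: proj_class_eq_iff intro: subspace_scale)
qed (use assms in \<open>auto simp: projectivization_def\<close>)

section \<open>Integral representatives and moves along rational lines\<close>

lemma subspace_over_rat_imp_subspace: "subspace_over_rat V \<Longrightarrow> subspace V"
  unfolding subspace_over_rat_def by auto

lemma integral_vec_imp_rational_vec: "integral_vec x \<Longrightarrow> rational_vec x"
  unfolding integral_vec_def rational_vec_def by (meson Ints_subset_Rats subsetD)

lemma norm_integral_vec_ge_1:
  fixes x :: "real^'n"
  assumes "integral_vec x" "x \<noteq> 0"
  shows "norm x \<ge> 1"
proof -
  obtain i where i: "x $ i \<noteq> 0"
    using assms by (auto simp: vec_eq_iff)
  then have "\<bar>x $ i\<bar> \<ge> 1"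
    using assms by (auto simp: integral_vec_def intro: Ints_nonzero_abs_ge1)
  then show ?thesis
    using component_le_norm_cart[of x i] by linarith
qed

lemma rational_vec_imp_integral_multiple:
  fixes x :: "real^'n"
  assumes "rational_vec x"
  obtains m :: nat where "m > 0" "integral_vec (real m *\<^sub>R x)"
proof -
  have "\<exists>d::nat. d > 0 \<and> real d * x $ i \<in> \<int>" for i
  proof -
    have "x $ i \<in> \<rat>"
      using assms by (simp add: rational_vec_def)
    then obtain a b where "b > 0" "x $ i = real_of_int a / real_of_int b"
      by (elim Rats_cases') auto
    then show ?thesis
      by (intro exI[of _ "nat b"]) auto
  qed
  then obtain d :: "'n \<Rightarrow> nat" where d: "\<And>i. d i > 0" "\<And>i. real (d i) * x $ i \<in> \<int>"
    by metis
  have "real (\<Prod>j\<in>UNIV. d j) * x $ i \<in> \<int>" for i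
  proof -
    have "real (\<Prod>j\<in>UNIV. d j) * x $ i = real (\<Prod>j\<in>UNIV - {i}. d j) * (real (d i) * x $ i)"
      by (subst prod.remove[of _ i]) auto
    then show ?thesis
      using d(2) by (metis Ints_mult Ints_of_nat)
  qed
  then show ?thesis
    using d(1) by (intro that[of "\<Prod>j\<in>UNIV. d j"]) (auto simp: integral_vec_def intro!: prod_pos)
qed

lemma rational_point_integral_representative:
  assumes "p \<in> rational_points Z"
  obtains x where "x \<noteq> 0" "integral_vec x" "p = proj_class x"
proof -
  obtain y where y: "y \<noteq> 0" "rational_vec y" "p = proj_class y"
    using assms by (auto simp: rational_points_def)
  obtain m :: nat where m: "m > 0" "integral_vec (real m *\<^sub>R y)"
    using y(2) by (rule rational_vec_imp_integral_multiple)
  have "proj_class y = proj_class (real m *\<^sub>R y)"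
    using y m by (subst proj_class_eq_iff) auto
  with y m show ?thesis
    by (intro that[of "real m *\<^sub>R y"]) auto
qed

text \<open>The plane over \<open>L\<close> has a rational spanning set, and by dimension some
  member of it lies off \<open>span {x}\<close>; clearing its denominators gives \<open>y\<close>.
  Then \<open>y + k x\<close> is a nonzero integral vector of the plane for every
  \<open>k\<close>.\<close>

lemma rational_line_second_point:
  fixes x :: "real^'n"
  assumes L: "proj_line_over_rat L" "proj_class x \<in> L" and x: "integral_vec x" "x \<noteq> 0"
  obtains y where "integral_vec y" "y \<notin> span {x}"
    "\<And>k::nat. proj_class (y + real k *\<^sub>R x) \<in> rational_points L"
proof -
  obtain V B where V: "dim V = 2" "L = projectivization V" "\<And>b. b \<in> B \<Longrightarrow> rational_vec b"
    "V = span B"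
    using L(1) unfolding proj_line_over_rat_def subspace_over_rat_def by auto
  have xV: "x \<in> V"
    using L V x by (metis proj_class_mem_projectivization_iff subspace_span)
  have "\<not> B \<subseteq> span {x}"
  proof
    assume "B \<subseteq> span {x}"
    then have "V \<subseteq> span {x}"
      unfolding V(4) by (simp add: span_minimal)
    then have "dim V \<le> card {x}"
      by (intro dim_le_card) auto
    with V(1) show False by simp
  qed
  then obtain b where b: "b \<in> B" "b \<notin> span {x}"
    by blast
  obtain m :: nat where m: "m > 0" "integral_vec (real m *\<^sub>R b)"
    using V(3)[OF b(1)] by (rule rational_vec_imp_integral_multiple)
  define y where "y = real m *\<^sub>R b"
  have y: "y \<notin> span {x}"
  proof
    assume "y \<in> span {x}"
    then have "(1 / real m) *\<^sub>R y \<in> span {x}"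
      by (rule span_scale)
    with b m show False
      by (simp add: y_def)
  qed
  have yV: "y \<in> V"
    using b by (simp add: y_def V(4) span_base span_scale)
  show ?thesis
  proof
    show "integral_vec y"
      using m by (simp add: y_def)
    fix k :: nat
    have "y + real k *\<^sub>R x \<noteq> 0"
    proof
      assume "y + real k *\<^sub>R x = 0"
      then have "y = (- real k) *\<^sub>R x"
        by (simp add: eq_neg_iff_add_eq_0)
      with y show False
        by (metis span_base span_scale singletonI)
    qed
    moreover have "integral_vec (y + real k *\<^sub>R x)"
      using \<open>integral_vec y\<close> x by (auto simp: integral_vec_def)
    moreover have "y + real k *\<^sub>R x \<in> V"
      using xV yV unfolding V(4) by (intro span_add span_scale)
    ultimately show "proj_class (y + real k *\<^sub>R x) \<in> rational_points L"
      using V(2) integral_vec_imp_rational_vec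
      by (auto simp: rational_points_def projectivization_def)
  qed (fact y)
qed

text \<open>All candidates \<open>u k\<close> have the same wedge norm \<open>w\<close> with
  \<open>x\<close>, so their classes lie at distance \<open>w / (norm x * norm (u k))\<close> from
  that of \<open>x\<close>, which tends to 0. The set \<open>B\<close> collects the points of the
  line at which the descent would fail.\<close>

lemma approximation_step:
  fixes x :: "real^'n"
  assumes L: "proj_line_over_rat L" "proj_class x \<in> L" and x: "integral_vec x" "x \<noteq> 0"
    and B: "finite B" and r: "r > 0"
    and lim: "filterlim (\<lambda>X. X * \<phi> X) at_top at_top"
  obtains y \<rho> where "integral_vec y" "y \<noteq> 0" "proj_class y \<in> rational_points L - B"
    "norm y \<ge> norm x + 1" "\<rho> > 0" "cball (proj_class y) \<rho> \<subseteq> cball (proj_class x) r"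
    "\<And>p. p \<in> cball (proj_class y) \<rho> \<Longrightarrow> approx_dist p x \<le> \<phi> (norm y)"
proof -
  obtain z where z: "integral_vec z" "z \<notin> span {x}"
    "\<And>k::nat. proj_class (z + real k *\<^sub>R x) \<in> rational_points L"
    using rational_line_second_point[OF L x] by blast
  define u where "u k = z + real k *\<^sub>R x" for k :: nat
  define w where "w = wedge_norm x z"
  have indep: "a = 0 \<and> b = 0" if "a *\<^sub>R z + b *\<^sub>R x = 0" for a b
  proof -
    have "a = 0"
    proof (rule ccontr)
      assume a: "a \<noteq> 0"
      have "a *\<^sub>R z = (- b) *\<^sub>R x"
        using that by (simp add: eq_neg_iff_add_eq_0)
      then have "z = (- b / a) *\<^sub>R x"
        using a by (metis (no_types) divide_inverse_commute real_vector.scale_left_imp_eq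
            scaleR_scaleR scaleR_one left_inverse)
      with z(2) show False
        by (metis span_base span_scale singletonI)
    qed
    with that x show ?thesis by simp
  qed
  have u0: "u k \<noteq> 0" for k
    using indep[of 1 "real k"] by (auto simp: u_def)
  \<comment> \<open>Distinct \<open>k\<close> give distinct points because \<open>z\<close> and
    \<open>x\<close> are independent, so the finite set \<open>B\<close> excludes only finitely many
    \<open>k\<close>.\<close>
  have inj: "inj (\<lambda>k. proj_class (u k))"
  proof (rule injI)
    fix j k assume "proj_class (u j) = proj_class (u k)"
    then obtain c where "u k = c *\<^sub>R u j"
      using u0 by (auto simp: proj_class_eq_iff)
    then have "(1 - c) *\<^sub>R z + (real k - c * real j) *\<^sub>R x = 0"
      by (simp add: u_def algebra_simps)
    from indep[OF this] show "j = k" by auto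
  qed
  have norm_u: "filterlim (\<lambda>k. norm (u k)) at_top sequentially"
  proof (rule filterlim_at_top_mono)
    show "filterlim (\<lambda>k. - norm z + norm x * real k) at_top sequentially"
      using x by (intro filterlim_tendsto_add_at_top[OF tendsto_const]
          filterlim_tendsto_pos_mult_at_top[OF tendsto_const] filterlim_real_sequentially) auto
    have "- norm z + norm x * real k \<le> norm (u k)" for k
      using norm_diff_ineq[of "real k *\<^sub>R x" z] by (simp add: u_def algebra_simps)
    then show "\<forall>\<^sub>F k in sequentially. - norm z + norm x * real k \<le> norm (u k)"
      by simp
  qed
  have "finite ((\<lambda>k. proj_class (u k)) -` B)"
    using B inj by (rule finite_vimageI)
  then have "\<forall>\<^sub>F k in sequentially. proj_class (u k) \<notin> B"
    by (simp add: cofinite_eq_sequentially[symmetric] eventually_cofinite vimage_def)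
  moreover have "\<forall>\<^sub>F k in sequentially. norm (u k) \<ge> norm x + 1"
    using norm_u by (simp add: filterlim_at_top)
  \<comment> \<open>This bound places the class of \<open>u k\<close> at distance less than
    \<open>r\<close> from that of \<open>x\<close>; the next one makes the distance less than
    \<open>\<phi> (norm (u k)) / norm x\<close>, by the growth of
    \<open>X * \<phi> X\<close>.\<close>
  moreover have "\<forall>\<^sub>F k in sequentially. norm (u k) > w / (norm x * r)"
    using norm_u by (simp add: filterlim_at_top_dense)
  moreover have "\<forall>\<^sub>F k in sequentially. norm (u k) * \<phi> (norm (u k)) > w"
    using filterlim_compose[OF lim norm_u] by (simp add: filterlim_at_top_dense)
  ultimately have "\<forall>\<^sub>F k in sequentially. proj_class (u k) \<notin> B \<and> norm (u k) \<ge> norm x + 1 \<and>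
      norm (u k) > w / (norm x * r) \<and> norm (u k) * \<phi> (norm (u k)) > w"
    by eventually_elim auto
  then obtain k where k: "proj_class (u k) \<notin> B" "norm (u k) \<ge> norm x + 1"
      "norm (u k) > w / (norm x * r)" "norm (u k) * \<phi> (norm (u k)) > w"
    using eventually_happens'[OF sequentially_bot] by blast
  define y where "y = u k"
  define d where "d = dist (proj_class x) (proj_class y)"
  have ny: "norm y > 0" and nx: "norm x > 0"
    using u0 x by (auto simp: y_def)
  have "wedge_norm x y = w"
    by (simp add: y_def u_def w_def wedge_norm_add_multiple)
  then have d: "d = w / (norm x * norm y)"
    using ny nx by (simp add: d_def dist_proj_class)
  have d_r: "d < r"
    using k(3) nx ny r by (simp add: d y_def field_simps)
  have d_\<phi>: "d < \<phi> (norm y) / norm x"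
    using k(4) nx ny by (simp add: d y_def field_simps)
  \<comment> \<open>The slack left by \<open>d\<close> in both radii: by the triangle inequality the
    new ball lies in the balls of radius \<open>r\<close> and
    \<open>\<phi> (norm y) / norm x\<close> around the class of \<open>x\<close>.\<close>
  define \<rho> where "\<rho> = min (r - d) (\<phi> (norm y) / norm x - d)"
  show ?thesis
  proof
    show "integral_vec y"
      using z(1) x by (auto simp: y_def u_def integral_vec_def)
    show "y \<noteq> 0" "norm y \<ge> norm x + 1"
      using ny k by (auto simp: y_def)
    show "proj_class y \<in> rational_points L - B"
      using z(3) k(1) by (auto simp: y_def u_def)
    show "\<rho> > 0"
      using d_r d_\<phi> by (simp add: \<rho>_def)
    have tri: "dist (proj_class x) p \<le> min r (\<phi> (norm y) / norm x)"
      if "p \<in> cball (proj_class y) \<rho>" for p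
      using that dist_triangle[of "proj_class x" p "proj_class y"]
      by (auto simp: \<rho>_def d_def)
    then show "cball (proj_class y) \<rho> \<subseteq> cball (proj_class x) r"
      by auto
    show "approx_dist p x \<le> \<phi> (norm y)" if "p \<in> cball (proj_class y) \<rho>" for p
      using tri[OF that] nx x by (simp add: approx_dist_eq_dist field_simps)
  qed
qed

section \<open>Descent and the construction of a limit point\<close>

text \<open>Here \<open>H\<close> is an arbitrary set, so that single points can be avoided by the
  same mechanism as rational hyperplanes.\<close>

definition descent_function :: "'n::finite rproj set \<Rightarrow> 'n rproj set \<Rightarrow> ('n rproj \<Rightarrow> nat) \<Rightarrow> bool" where
  "descent_function Z' H s \<longleftrightarrow> (\<forall>x\<in>Z'.
     (s x = 0 \<longrightarrow> x \<notin> H) \<and>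
     (s x \<ge> 1 \<longrightarrow> (\<exists>L. proj_line_over_rat L \<and> x \<in> rational_points L
        \<and> rational_points L \<subseteq> Z' \<and> finite {y \<in> rational_points L. s y \<ge> s x})))"

text \<open>If \<open>s\<close> vanishes at the current point, this point lies off the closed set
  \<open>F\<close>, and cutting the radius down keeps the next ball off \<open>F\<close>. As
  \<open>s\<close> provides no line in this case, one is taken from \<open>lines\<close>. Otherwise
  the descent line has only finitely many rational points where \<open>s\<close> fails to drop, and
  these form the set \<open>B\<close> of \<open>approximation_step\<close>.\<close>

lemma approximation_descent_step:
  fixes x :: "real^'n"
  assumes x: "integral_vec x" "x \<noteq> 0" "proj_class x \<in> Z'" and r: "r > 0"
    and lines: "\<And>p. p \<in> Z' \<Longrightarrow>
      \<exists>L. proj_line_over_rat L \<and> p \<in> rational_points L \<and> rational_points L \<subseteq> Z'"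
    and F: "closed F" "descent_function Z' F s"
    and lim: "filterlim (\<lambda>X. X * \<phi> X) at_top at_top"
  shows "\<exists>y \<rho>. integral_vec y \<and> y \<noteq> 0 \<and> proj_class y \<in> Z' \<and> norm y \<ge> norm x + 1 \<and> \<rho> > 0 \<and>
     cball (proj_class y) \<rho> \<subseteq> cball (proj_class x) r \<and>
     (\<forall>p\<in>cball (proj_class y) \<rho>. approx_dist p x \<le> \<phi> (norm y)) \<and>
     (if s (proj_class x) = 0 then cball (proj_class y) \<rho> \<inter> F = {}
      else s (proj_class y) < s (proj_class x))"
proof (cases "s (proj_class x) = 0")
  case True
  then have "proj_class x \<in> - F" "open (- F)"
    using F x by (auto simp: descent_function_def)
  then obtain e where e: "e > 0" "cball (proj_class x) e \<subseteq> - F"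
    using open_contains_cball by blast
  obtain L where L: "proj_line_over_rat L" "proj_class x \<in> L" "rational_points L \<subseteq> Z'"
    using lines[OF x(3)] by (auto simp: rational_points_def)
  have "min r e > 0"
    using r e by simp
  from approximation_step[OF L(1,2) x(1,2) finite.emptyI this lim]
  obtain y \<rho> where "integral_vec y" "y \<noteq> 0" "proj_class y \<in> rational_points L - {}"
    "norm y \<ge> norm x + 1" "\<rho> > 0" "cball (proj_class y) \<rho> \<subseteq> cball (proj_class x) (min r e)"
    "\<And>p. p \<in> cball (proj_class y) \<rho> \<Longrightarrow> approx_dist p x \<le> \<phi> (norm y)"
    by blast
  moreover from this(6) have "cball (proj_class y) \<rho> \<subseteq> cball (proj_class x) r"
    "cball (proj_class y) \<rho> \<subseteq> cball (proj_class x) e"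
    by (auto simp: subset_iff)
  ultimately show ?thesis
    using L(3) e(2) True by (intro exI[of _ y] exI[of _ \<rho>]) auto
next
  case False
  then have "s (proj_class x) \<ge> 1"
    by simp
  then obtain L where L: "proj_line_over_rat L" "proj_class x \<in> rational_points L"
    "rational_points L \<subseteq> Z'" "finite {y \<in> rational_points L. s y \<ge> s (proj_class x)}"
    using F(2) x(3) unfolding descent_function_def by blast
  then have "proj_class x \<in> L"
    by (simp add: rational_points_def)
  from approximation_step[OF L(1) this x(1,2) L(4) r lim]
  obtain y \<rho> where y: "integral_vec y" "y \<noteq> 0"
    "proj_class y \<in> rational_points L - {y \<in> rational_points L. s y \<ge> s (proj_class x)}"
    "norm y \<ge> norm x + 1" "\<rho> > 0" "cball (proj_class y) \<rho> \<subseteq> cball (proj_class x) r"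
    "\<And>p. p \<in> cball (proj_class y) \<rho> \<Longrightarrow> approx_dist p x \<le> \<phi> (norm y)"
    by blast
  then show ?thesis
    using L(3) False by (intro exI[of _ y] exI[of _ \<rho>]) auto
qed

text \<open>A state consists of an integral representative of the current point, the radius of the current
  ball and the index \<open>i\<close> of the set \<open>F i\<close> to be avoided next.  The index is increased as soon as
  \<open>s i\<close> vanishes; until then \<open>s i\<close> decreases, so every index is reached.\<close>

lemma exists_well_approximable_avoiding:
  fixes Z Z' :: "'n::finite rproj set" and F :: "nat \<Rightarrow> 'n rproj set"
  assumes Z: "closed Z" "Z' \<noteq> {}" "Z' \<subseteq> rational_points Z"
    and lines: "\<And>p. p \<in> Z' \<Longrightarrow>
      \<exists>L. proj_line_over_rat L \<and> p \<in> rational_points L \<and> rational_points L \<subseteq> Z'"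
    and F: "\<And>i. closed (F i)" "\<And>i. descent_function Z' (F i) (s i)"
    and anti: "antimono_on {1..} \<phi>"
    and lim: "filterlim (\<lambda>X. X * \<phi> X) at_top at_top"
  shows "\<exists>\<xi>\<in>Z. (\<forall>i. \<xi> \<notin> F i) \<and> (\<forall>\<^sub>F X in at_top. min_approx \<xi> X \<le> \<phi> X)"
proof -
  \<comment> \<open>The last conjunct starts the construction at index 0, so that no
    \<open>F i\<close> is skipped.\<close>
  define P where "P = (\<lambda>(n::nat) (x::real^'n, r::real, i::nat).
    integral_vec x \<and> x \<noteq> 0 \<and> proj_class x \<in> Z' \<and> r > 0 \<and> (n = 0 \<longrightarrow> i = 0))"
  define Q where "Q = (\<lambda>(n::nat) (x::real^'n, r::real, i::nat) (y::real^'n, \<rho>::real, j::nat).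
    norm y \<ge> norm x + 1 \<and> cball (proj_class y) \<rho> \<subseteq> cball (proj_class x) r \<and>
    (\<forall>p\<in>cball (proj_class y) \<rho>. approx_dist p x \<le> \<phi> (norm y)) \<and>
    (if s i (proj_class x) = 0 then j = Suc i \<and> cball (proj_class y) \<rho> \<inter> F i = {}
     else j = i \<and> s i (proj_class y) < s i (proj_class x)))"
  obtain p where p: "p \<in> Z'"
    using Z(2) by blast
  then obtain x0 where x0: "x0 \<noteq> 0" "integral_vec x0" "p = proj_class x0"
    using Z(3) by (auto elim: rational_point_integral_representative)
  obtain f where f: "\<And>n. P n (f n)" "\<And>n. Q n (f n) (f (Suc n))"
  proof (rule dependent_nat_choice[of P Q, THEN exE])
    show "\<exists>t. P 0 t"
      using x0 p by (intro exI[of _ "(x0, 1, 0)"]) (auto simp: P_def)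
    fix t n assume "P n t"
    then obtain x r i where t: "t = (x, r, i)"
      and x: "integral_vec x" "x \<noteq> 0" "proj_class x \<in> Z'" "r > 0"
      by (cases t) (auto simp: P_def)
    obtain y \<rho> where "integral_vec y" "y \<noteq> 0" "proj_class y \<in> Z'" "norm y \<ge> norm x + 1" "\<rho> > 0"
      "cball (proj_class y) \<rho> \<subseteq> cball (proj_class x) r"
      "\<forall>p\<in>cball (proj_class y) \<rho>. approx_dist p x \<le> \<phi> (norm y)"
      "if s i (proj_class x) = 0 then cball (proj_class y) \<rho> \<inter> F i = {}
       else s i (proj_class y) < s i (proj_class x)"
      using approximation_descent_step[OF x lines F(1,2) lim] by blast
    then show "\<exists>t'. P (Suc n) t' \<and> Q n t t'"
      by (intro exI[of _ "(y, \<rho>, if s i (proj_class x) = 0 then Suc i else i)"])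
        (auto simp: P_def Q_def t)
  qed auto
  define x where "x n = fst (f n)" for n
  define r where "r n = fst (snd (f n))" for n
  define i where "i n = snd (snd (f n))" for n
  define K where "K n = cball (proj_class (x n)) (r n)" for n
  have f_eq: "f n = (x n, r n, i n)" for n
    by (simp add: x_def r_def i_def)
  have x: "integral_vec (x n)" "x n \<noteq> 0" "proj_class (x n) \<in> Z'" "r n > 0" for n
    using f(1)[of n] by (auto simp: P_def f_eq)
  have norm_Suc: "norm (x (Suc n)) \<ge> norm (x n) + 1"
    and K_Suc: "K (Suc n) \<subseteq> K n"
    and approx: "p \<in> K (Suc n) \<Longrightarrow> approx_dist p (x n) \<le> \<phi> (norm (x (Suc n)))"
    and index: "if s (i n) (proj_class (x n)) = 0 then i (Suc n) = Suc (i n) \<and> K (Suc n) \<inter> F (i n) = {}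
      else i (Suc n) = i n \<and> s (i n) (proj_class (x (Suc n))) < s (i n) (proj_class (x n))" for n p
    using f(2)[of n] by (auto simp: Q_def f_eq K_def split: if_splits)

  \<comment> \<open>The centres lie in \<open>Z\<close>, so compactness yields a common point of the
    nested balls inside the closed set \<open>Z\<close>.\<close>
  have "(\<Inter>n. K n \<inter> Z) \<noteq> {}"
  proof (rule compact_space_imp_nest)
    show "compact_space (euclidean :: 'n rproj topology)"
      using compact_UNIV_rproj by (simp add: compact_space_def)
    show "closedin euclidean (K n \<inter> Z)" for n
      using Z(1) by (simp add: K_def closed_Int)
    have "proj_class (x n) \<in> K n \<inter> Z" for n
      using x(3,4)[of n] Z(3) by (auto simp: K_def rational_points_def)
    then show "K n \<inter> Z \<noteq> {}" for n
      by blast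
    show "decseq (\<lambda>n. K n \<inter> Z)"
      using K_Suc by (intro decseq_SucI) blast
  qed
  then obtain \<xi> where \<xi>: "\<xi> \<in> Z" "\<And>n. \<xi> \<in> K n"
    by blast

  have pass: "\<exists>m. i m = i n \<and> s (i m) (proj_class (x m)) = 0" for n
  proof (induction "s (i n) (proj_class (x n))" arbitrary: n rule: less_induct)
    case less
    show ?case
    proof (cases "s (i n) (proj_class (x n)) = 0")
      case False
      then have "i (Suc n) = i n" "s (i n) (proj_class (x (Suc n))) < s (i n) (proj_class (x n))"
        using index[of n] by auto
      then show ?thesis
        using less[of "Suc n"] by auto
    qed auto
  qed
  have "i 0 = 0"
    using f(1)[of 0] by (simp add: P_def f_eq)
  have reached: "\<exists>m. i m = k \<and> s k (proj_class (x m)) = 0" for k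
  proof (induction k)
    case 0
    show ?case using pass[of 0] \<open>i 0 = 0\<close> by auto
  next
    case (Suc k)
    then obtain m where "i m = k" "s k (proj_class (x m)) = 0"
      by blast
    then have "i (Suc m) = Suc k"
      using index[of m] by auto
    then show ?case
      using pass[of "Suc m"] by auto
  qed
  \<comment> \<open>At a stage \<open>m\<close> with \<open>i m = k\<close> where \<open>s k\<close>
    vanishes, the ball \<open>K (Suc m)\<close> misses \<open>F k\<close>, and it contains
    \<open>\<xi>\<close>.\<close>
  have "\<xi> \<notin> F k" for k
    using reached[of k] index \<xi>(2) by (metis IntI emptyE)

  have norm_ge: "norm (x n) \<ge> 1 + real n" for n
  proof (induction n)
    case 0
    show ?case using norm_integral_vec_ge_1[OF x(1,2)] by simp
  next
    case (Suc n)
    then show ?case using norm_Suc[of n] by simp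
  qed
  \<comment> \<open>The norms are unbounded, so \<open>X\<close> falls between two consecutive ones.
    Then \<open>x n\<close> is admissible in the minimum, and the bound
    \<open>\<phi> (norm (x (Suc n)))\<close> is at most \<open>\<phi> X\<close> by
    monotonicity.\<close>
  have "min_approx \<xi> X \<le> \<phi> X" if X: "X \<ge> norm (x 0)" for X
  proof -
    obtain m where m: "real m \<ge> X"
      using real_arch_simple by blast
    have "\<exists>n. norm (x n) \<le> X \<and> X < norm (x (Suc n))"
    proof (rule ccontr)
      assume *: "\<nexists>n. norm (x n) \<le> X \<and> X < norm (x (Suc n))"
      have "norm (x n) \<le> X" for n
        using X * by (induction n) (auto simp: not_less)
      with norm_ge[of m] m show False
        by (smt (verit))
    qed
    then obtain n where n: "norm (x n) \<le> X" "X < norm (x (Suc n))"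
      by blast
    have "approx_dist \<xi> (x n) \<in> approx_set \<xi> X"
      using x n by (auto simp: approx_set_def)
    then have "min_approx \<xi> X \<le> approx_dist \<xi> (x n)"
      unfolding min_approx_def by (intro Min_le finite_approx_set)
    also have "\<dots> \<le> \<phi> (norm (x (Suc n)))"
      using approx \<xi>(2) by blast
    also have "\<dots> \<le> \<phi> X"
      using n norm_ge[of n] by (intro monotone_onD[OF anti]) auto
    finally show ?thesis .
  qed
  then have "\<forall>\<^sub>F X in at_top. min_approx \<xi> X \<le> \<phi> X"
    unfolding eventually_at_top_linorder by blast
  with \<open>\<xi> \<in> Z\<close> \<open>\<And>k. \<xi> \<notin> F k\<close> show ?thesis
    by blast
qed

section \<open>Rational hyperplanes, rational points and independent coordinates\<close>

lemma subspace_over_rat_hyperplane: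
  fixes c :: "'n::finite \<Rightarrow> rat"
  assumes "c k \<noteq> 0"
  shows "subspace_over_rat {x :: real^'n. (\<Sum>i\<in>UNIV. of_rat (c i) * x $ i) = 0}" (is "subspace_over_rat ?V")
proof -
  define a :: "'n \<Rightarrow> real" where "a i = of_rat (c i)" for i
  have ak: "a k \<noteq> 0"
    using assms by (simp add: a_def)
  \<comment> \<open>Unit vectors corrected in coordinate \<open>k\<close> so as to lie in the
    hyperplane; \<open>b k\<close> is 0. A vector \<open>x\<close> of the hyperplane is the
    combination of the \<open>b j\<close> with its own coordinates, since the total correction is
    the defining linear form divided by \<open>a k\<close>.\<close>
  define b :: "'n \<Rightarrow> real^'n" where "b j = axis j 1 - (a j / a k) *\<^sub>R axis k 1" for j
  have b_nth: "b j $ l = (if l = j then 1 else 0) - (if l = k then a j / a k else 0)" for j l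
    by (simp add: b_def axis_def)
  have "rational_vec (b j)" for j
    unfolding rational_vec_def b_nth by (auto simp: a_def)
  moreover have "?V = span (range b)"
  proof
    show "?V \<subseteq> span (range b)"
    proof
      fix x :: "real^'n" assume "x \<in> ?V"
      then have sum0: "(\<Sum>j\<in>UNIV. a j * x $ j) = 0"
        by (simp add: a_def)
      have "x = (\<Sum>j\<in>UNIV. x $ j *\<^sub>R b j)"
      proof (subst vec_eq_iff, rule allI)
        fix l
        have "x $ j * b j $ l = (if l = j then x $ j else 0) - (if l = k then a j * x $ j / a k else 0)"
          for j
          by (simp add: b_nth algebra_simps)
        then have "(\<Sum>j\<in>UNIV. x $ j *\<^sub>R b j) $ l
            = x $ l - (if l = k then (\<Sum>j\<in>UNIV. a j * x $ j) / a k else 0)"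
          by (simp add: sum_subtractf sum_divide_distrib)
        then show "x $ l = (\<Sum>j\<in>UNIV. x $ j *\<^sub>R b j) $ l"
          by (simp add: sum0)
      qed
      also have "\<dots> \<in> span (range b)"
        by (intro span_sum span_scale span_base) auto
      finally show "x \<in> span (range b)" .
    qed
    have "subspace ?V"
      by (auto simp: subspace_def algebra_simps sum.distrib simp flip: sum_distrib_left)
    moreover have "(\<Sum>i\<in>UNIV. a i * b j $ i) = 0" for j
    proof -
      have "a i * b j $ i = (if i = j then a i else 0) - (if i = k then a j else 0)" for i
        using ak by (simp add: b_nth algebra_simps)
      then show ?thesis
        by (simp add: sum_subtractf)
    qed
    ultimately show "span (range b) \<subseteq> ?V"
      by (intro span_minimal) (auto simp: a_def)
  qed
  ultimately show ?thesis
    unfolding subspace_over_rat_def by blast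
qed

lemma projectivization_ne_UNIV:
  fixes V :: "(real^'n::finite) set"
  assumes "subspace V" "v \<notin> V"
  shows "projectivization V \<noteq> UNIV"
proof -
  have "v \<noteq> 0"
    using assms subspace_0 by blast
  then have "proj_class v \<notin> projectivization V"
    using assms by (simp add: proj_class_mem_projectivization_iff)
  then show ?thesis by blast
qed

text \<open>The hypothesis is applied to the point \<open>p\<close> itself as a rational subspace
  \<open>H\<close>. Since \<open>p\<close> lies in \<open>H\<close>, its value under
  \<open>s\<close> cannot be 0, and a line is obtained.\<close>

lemma rational_point_line:
  fixes Z' :: "'n::finite rproj set"
  assumes card: "CARD('n) \<ge> 2" and Z': "Z' \<subseteq> rational_points Z" and p: "p \<in> Z'"
    and descent: "\<And>H. proj_subspace_over_rat H \<Longrightarrow> H \<noteq> UNIV \<Longrightarrow> \<exists>s. descent_function Z' H s"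
  shows "\<exists>L. proj_line_over_rat L \<and> p \<in> rational_points L \<and> rational_points L \<subseteq> Z'"
proof -
  obtain x where x: "x \<noteq> 0" "integral_vec x" "p = proj_class x"
    using p Z' by (auto elim: rational_point_integral_representative)
  have "dim (span {x}) \<le> 1"
    using dim_le_card'[of "{x}"] by simp
  then have "span {x} \<noteq> UNIV"
    using card by (metis DIM_cart DIM_real dim_UNIV mult.right_neutral not_less_eq_eq numeral_2_eq_2
        One_nat_def le_trans)
  then obtain v where "v \<notin> span {x}"
    by blast
  then have "projectivization (span {x}) \<noteq> UNIV"
    by (simp add: projectivization_ne_UNIV)
  moreover have "subspace_over_rat (span {x})"
    using integral_vec_imp_rational_vec[OF x(2)]
    unfolding subspace_over_rat_def by (intro exI[of _ "{x}"]) simp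
  then have "proj_subspace_over_rat (projectivization (span {x}))"
    by (auto simp: proj_subspace_over_rat_def)
  ultimately obtain s where s: "descent_function Z' (projectivization (span {x})) s"
    using descent by blast
  have "p \<in> projectivization (span {x})"
    using x by (simp add: proj_class_mem_projectivization_iff span_base)
  with s p have "s p \<ge> 1"
    by (auto simp: descent_function_def Suc_le_eq)
  with s p show ?thesis
    unfolding descent_function_def by blast
qed

text \<open>A rational point satisfies rational linear relations, as two of its coordinates always
  have a rational dependence. Hence a point with independent coordinates is never in
  \<open>Z'\<close>.\<close>

lemma li_points_disjoint_rational_points:
  fixes Z Z' :: "'n::finite rproj set"
  assumes "CARD('n) \<ge> 2"
  shows "li_points Z \<inter> rational_points Z' = {}"
proof -
  have False if li: "p \<in> li_points Z" and rat: "p \<in> rational_points Z'" for p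
  proof -
    obtain x where x: "x \<noteq> 0" "p = proj_class x" "rat_independent_coords x"
      using li unfolding li_points_def by blast
    obtain y where y: "y \<noteq> 0" "p = proj_class y" "integral_vec y"
      using rat by (rule rational_point_integral_representative)
    obtain a where a: "x = a *\<^sub>R y"
      using x y proj_class_eq_iff by metis
    obtain k l :: 'n where kl: "k \<noteq> l"
      using assms card_2_iff' card_le_Suc0_iff_eq[of "UNIV :: 'n set"] by fastforce
    have "\<exists>q. y $ i = of_rat q" for i
      using integral_vec_imp_rational_vec[OF y(3)] by (auto simp: rational_vec_def Rats_def)
    then obtain q :: "'n \<Rightarrow> rat" where q: "\<And>i. y $ i = of_rat (q i)"
      by metis
    \<comment> \<open>The coefficients of the relation \<open>q m * x $ k - q k * x $ m = 0\<close>,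
      which holds because \<open>x\<close> is proportional to \<open>y\<close>. Its vanishing for
      some \<open>m\<close> other than \<open>k\<close> forces \<open>q k = 0\<close>, so that
      \<open>x $ k = 0\<close> is itself a forbidden relation.\<close>
    define c where "c m j = (if j = m then - q k else 0) + (if j = k then q m else 0)" for m j
    have "(\<Sum>j\<in>UNIV. of_rat (c m j) * x $ j) = 0" for m
      by (simp add: c_def a q of_rat_add of_rat_minus distrib_right sum.distrib if_distrib
          [where f = of_rat] if_distrib[where f = "\<lambda>t. t * _"] cong: if_cong)
    then have c0: "c m j = 0" for m j
      using x(3) unfolding rat_independent_coords_def by blast
    have "q k = 0"
      using c0[of l l] kl by (simp add: c_def)
    then have "x $ k = 0"
      by (simp add: a q)
    then have "(\<Sum>j\<in>UNIV. of_rat (if j = k then 1 else 0) * x $ j) = 0"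
      by (auto intro!: sum.neutral)
    then have "(if k = k then 1 else 0 :: rat) = 0"
      using x(3)[unfolded rat_independent_coords_def, rule_format,
        of "\<lambda>j. if j = k then 1 else 0" k] by simp
    then show False by simp
  qed
  then show ?thesis by blast
qed

section \<open>Avoiding all rational hyperplanes and a countable set of solutions\<close>

theorem theorem2p1:
  fixes n :: nat
    and Z Z' :: "'n::finite rproj set"
    and \<phi> :: "real \<Rightarrow> real"
  assumes "n \<ge> 2"
    and "CARD('n) = n + 1"
    and "closed Z"
    and "Z' \<noteq> {}"
    and "Z' \<subseteq> rational_points Z"
    and "\<And>H. proj_subspace_over_rat H \<Longrightarrow> H \<noteq> UNIV \<Longrightarrow>
           \<exists>s :: 'n rproj \<Rightarrow> nat. \<forall>x\<in>Z'.
             (s x = 0 \<longrightarrow> x \<notin> H) \<and>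
             (s x \<ge> 1 \<longrightarrow> (\<exists>L. proj_line_over_rat L \<and> x \<in> rational_points L
                \<and> rational_points L \<subseteq> Z'
                \<and> finite {y \<in> rational_points L. s y \<ge> s x}))"
    and "\<And>X. X \<ge> 1 \<Longrightarrow> 0 < \<phi> X \<and> \<phi> X \<le> 1"
    and "antimono_on {1..} \<phi>"
    and "(\<phi> \<longlongrightarrow> 0) at_top"
    and "filterlim (\<lambda>X. X * \<phi> X) at_top at_top"
  shows "uncountable {\<xi> \<in> li_points Z. \<forall>\<^sub>F X in at_top. min_approx \<xi> X \<le> \<phi> X}"
    (is "uncountable ?A")
proof
  assume "countable ?A"
  have card: "CARD('n) \<ge> 2"
    using assms(1,2) by simp
  have descent: "\<exists>s. descent_function Z' H s" if "proj_subspace_over_rat H" "H \<noteq> UNIV" for H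
    unfolding descent_function_def using assms(6)[OF that] .
  define V :: "('n \<Rightarrow> rat) \<Rightarrow> (real^'n) set" where
    "V c = {x. (\<Sum>i\<in>UNIV. of_rat (c i) * x $ i) = 0}" for c
  define C where "C = {c :: 'n \<Rightarrow> rat. \<exists>i. c i \<noteq> 0}"
  \<comment> \<open>Avoiding the first kind of set gives linearly independent coordinates; avoiding
    the second gives a point outside \<open>?A\<close>. The family is countable, as there are
    countably many rational coefficient functions.\<close>
  define \<F> where "\<F> = (\<lambda>c. projectivization (V c)) ` C \<union> (\<lambda>\<xi>. {\<xi>}) ` ?A"
  have V_rat: "subspace_over_rat (V c)" if "c \<in> C" for c
    using that subspace_over_rat_hyperplane unfolding C_def V_def by blast
  have \<F>: "closed H \<and> (\<exists>s. descent_function Z' H s)" if H: "H \<in> \<F>" for H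
  proof -
    consider c where "c \<in> C" "H = projectivization (V c)" | \<xi> where "\<xi> \<in> li_points Z" "H = {\<xi>}"
      using H unfolding \<F>_def by blast
    then show ?thesis
    proof cases
      case 1
      then obtain k where k: "c k \<noteq> 0"
        by (auto simp: C_def)
      have "(\<Sum>i\<in>UNIV. of_rat (c i) * axis k (1::real) $ i) = of_rat (c k)"
        by (simp add: axis_def if_distrib cong: if_cong)
      with k have "axis k 1 \<notin> V c"
        by (simp add: V_def)
      moreover have sub: "subspace (V c)"
        using V_rat[OF 1(1)] by (rule subspace_over_rat_imp_subspace)
      ultimately have "H \<noteq> UNIV"
        using projectivization_ne_UNIV 1(2) by blast
      moreover have "proj_subspace_over_rat H"
        using V_rat[OF 1(1)] 1(2) unfolding proj_subspace_over_rat_def by blast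
      moreover have "closed H"
        using compact_projectivization[OF sub] 1(2) by (simp add: compact_imp_closed)
      ultimately show ?thesis
        using descent by blast
    next
      case 2
      then have "\<xi> \<notin> Z'"
        using li_points_disjoint_rational_points[OF card, of Z Z] assms(5) by blast
      \<comment> \<open>The single point lies outside \<open>Z'\<close>, so the zero function
        satisfies (i), and (ii) is vacuous.\<close>
      then have "descent_function Z' H (\<lambda>_. 0)"
        using 2 by (auto simp: descent_function_def)
      with 2 show ?thesis by auto
    qed
  qed
  have "countable \<F>"
    unfolding \<F>_def using \<open>countable ?A\<close> by (intro countable_Un countable_image) auto
  \<comment> \<open>Nonemptiness is what allows the countable family to be enumerated as the range
    of a sequence.\<close>
  moreover have "(\<lambda>_. 1) \<in> C"
    by (auto simp: C_def)
  then have "\<F> \<noteq> {}"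
    unfolding \<F>_def by blast
  ultimately obtain F :: "nat \<Rightarrow> 'n rproj set" where F: "\<F> = range F"
    by (metis range_from_nat_into)
  then have closed: "closed (F i)" and "\<exists>s. descent_function Z' (F i) s" for i
    using \<F> by blast+
  then obtain s where s: "\<And>i. descent_function Z' (F i) (s i)"
    by metis
  obtain \<xi> where \<xi>: "\<xi> \<in> Z" "\<And>i. \<xi> \<notin> F i" "\<forall>\<^sub>F X in at_top. min_approx \<xi> X \<le> \<phi> X"
    using exists_well_approximable_avoiding[where F = F and s = s, OF assms(3-5)
        rational_point_line[OF card assms(5) _ descent] closed s assms(8,10)] by blast
  then have avoid: "\<xi> \<notin> H" if "H \<in> \<F>" for H
    using F that by blast
  obtain x where x: "x \<noteq> 0" "\<xi> = proj_class x"
    by (rule proj_class_cases)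
  have "rat_independent_coords x"
    unfolding rat_independent_coords_def
  proof (intro allI impI, rule ccontr)
    fix c i assume "(\<Sum>i\<in>UNIV. of_rat (c i) * x $ i) = 0" and "c i \<noteq> (0::rat)"
    then have "x \<in> V c" "c \<in> C"
      by (auto simp: V_def C_def)
    with x avoid show False
      unfolding \<F>_def projectivization_def by blast
  qed
  then have "\<xi> \<in> ?A"
    using \<xi> x by (auto simp: li_points_def)
  then show False
    using avoid unfolding \<F>_def by blast
qed

end
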